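(* Let $G$ be a finitely generated group and let $\varphi\in\mathrm{Aut}(G)$. Suppose there is a nontrivial homomorphism $f\in\mathrm{Hom}(G,A)$ with $A$ an abelian group and $f(G)$ containing an element of infinite order. Assume further that there exists a $\varphi$-invariant normal subgroup $N\trianglelefteq G$ contained in $\ker(f)$, and let $$\overline{\varphi}\in\mathrm{Aut}(G/N),\quad gN\mapsto\varphi(g)N,\qquad \overline{f}\in\mathrm{Hom}(G/N,A),\quad gN\mapsto f(g)$$ be the maps induced by $\varphi$ and $f$ on $G/N$. If $\overline{f}\circ\overline{\varphi}=\overline{f}$, then $\mathrm{Fix}(\varphi^{\mathrm{ab}})$ is infinite.
   Context: $\varphi$-invariant means $\varphi(N)=N$. $\varphi^{\mathrm{ab}}$ is the automorphism $g[G,G]\mapsto\varphi(g)[G,G]$ of the abelianization $G^{\mathrm{ab}}=G/[G,G]$, and $\mathrm{Fix}(\psi)=\{g\mid\psi(g)=g\}$ is the subgroup of fixed points of an automorphism $\psi$. *)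

theory Defs
  imports "HOL-Algebra.Algebra"
begin

definition finitely_generated_group :: "('a, 'm) monoid_scheme \<Rightarrow> bool" where
  "finitely_generated_group G \<longleftrightarrow>
     (\<exists>S. finite S \<and> S \<subseteq> carrier G \<and> generate G S = carrier G)"

definition Fix :: "('a, 'm) monoid_scheme \<Rightarrow> ('a \<Rightarrow> 'a) \<Rightarrow> 'a set" where
  "Fix G \<psi> = {g \<in> carrier G. \<psi> g = g}"

text \<open>
  The map on \<open>G Mod N\<close> given by \<open>gN \<mapsto> h g\<close>. It is meaningful when \<open>h\<close> is constant on the cosets
  of \<open>N\<close>. The carrier of \<open>G Mod N\<close> consists of the right cosets \<open>N #> g\<close>, which are the left
  cosets \<open>gN\<close> when \<open>N\<close> is normal.
\<close>

definition quotient_map :: "('a, 'm) monoid_scheme \<Rightarrow> 'a set \<Rightarrow> ('a \<Rightarrow> 'b) \<Rightarrow> 'a set \<Rightarrow> 'b" where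
  "quotient_map G N h C = (THE y. \<exists>g\<in>carrier G. C = N #>\<^bsub>G\<^esub> g \<and> y = h g)"

definition quotient_endo :: "('a, 'm) monoid_scheme \<Rightarrow> 'a set \<Rightarrow> ('a \<Rightarrow> 'a) \<Rightarrow> 'a set \<Rightarrow> 'a set" where
  "quotient_endo G N \<phi> = quotient_map G N (\<lambda>g. N #>\<^bsub>G\<^esub> \<phi> g)"

definition abelianization :: "('a, 'm) monoid_scheme \<Rightarrow> 'a set monoid" where
  "abelianization G = G Mod derived G (carrier G)"

definition abelianization_map :: "('a, 'm) monoid_scheme \<Rightarrow> ('a \<Rightarrow> 'a) \<Rightarrow> 'a set \<Rightarrow> 'a set" where
  "abelianization_map G \<phi> = quotient_endo G (derived G (carrier G)) \<phi>"

lemma (in normal) rcos_eq_imp_diff: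
  assumes "x \<in> carrier G" "y \<in> carrier G" "H #> x = H #> y"
  shows "\<exists>n\<in>H. x = n \<otimes> y"
proof -
  have "x \<in> H #> y" using assms rcos_self[OF assms(1) is_subgroup] by simp
  then show ?thesis by (auto simp: r_coset_def)
qed

lemma (in normal) quotient_map_rcos:
  assumes const: "\<And>n x. n \<in> H \<Longrightarrow> x \<in> carrier G \<Longrightarrow> h (n \<otimes> x) = h x" and g: "g \<in> carrier G"
  shows "quotient_map G H h (H #> g) = h g"
  unfolding quotient_map_def
proof (rule the_equality)
  show "\<exists>g'\<in>carrier G. H #> g = H #> g' \<and> h g = h g'" using g by blast
next
  fix y assume "\<exists>g'\<in>carrier G. H #> g = H #> g' \<and> y = h g'"
  then obtain g' where g': "g' \<in> carrier G" "H #> g = H #> g'" "y = h g'" by blast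
  obtain n where "n \<in> H" "g = n \<otimes> g'" using rcos_eq_imp_diff[OF g g'(1,2)] by blast
  then show "y = h g" using const[of n g'] g' by simp
qed

lemma (in normal) quotient_map_hom:
  assumes "group A" "f \<in> hom G A" "H \<subseteq> kernel G A f"
  shows "\<And>g. g \<in> carrier G \<Longrightarrow> quotient_map G H f (H #> g) = f g"
    and "quotient_map G H f \<in> hom (G Mod H) A"
proof -
  interpret A: group A by fact
  interpret f: group_hom G A f using assms by unfold_locales
  have "f (n \<otimes> x) = f x" if "n \<in> H" "x \<in> carrier G" for n x
    using that assms(3) by (auto simp: kernel_def)
  then show *: "quotient_map G H f (H #> g) = f g" if "g \<in> carrier G" for g
    using quotient_map_rcos that by blast
  show "quotient_map G H f \<in> hom (G Mod H) A"
    by (rule homI) (auto simp: FactGroup_def RCOSETS_def rcos_sum *)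
qed

lemma (in normal) quotient_endo_iso:
  assumes "\<phi> \<in> iso G G" "\<phi> ` H = H"
  shows "\<And>g. g \<in> carrier G \<Longrightarrow> quotient_endo G H \<phi> (H #> g) = H #> \<phi> g"
    and "quotient_endo G H \<phi> \<in> iso (G Mod H) (G Mod H)"
proof -
  interpret \<phi>: group_hom G G \<phi> using assms by unfold_locales (auto simp: iso_def)
  have bij: "bij_betw \<phi> (carrier G) (carrier G)" using assms by (simp add: iso_def)
  have "H #> \<phi> (n \<otimes> x) = H #> \<phi> x" if "n \<in> H" "x \<in> carrier G" for n x
  proof -
    have "\<phi> n \<in> H" using that assms(2) by blast
    then have "H #> \<phi> n = H" by (rule rcos_const[OF is_group])
    then show ?thesis using that coset_mult_assoc[OF subset, of "\<phi> n" "\<phi> x"] by simp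
  qed
  then show *: "quotient_endo G H \<phi> (H #> g) = H #> \<phi> g" if "g \<in> carrier G" for g
    unfolding quotient_endo_def by (rule quotient_map_rcos[where h = "\<lambda>g. H #> \<phi> g", OF _ that])
  have hom: "quotient_endo G H \<phi> \<in> hom (G Mod H) (G Mod H)"
    by (rule homI) (auto simp: FactGroup_def RCOSETS_def rcos_sum *)
  have "inj_on (quotient_endo G H \<phi>) (carrier (G Mod H))"
  proof (rule inj_onI)
    fix C D assume "C \<in> carrier (G Mod H)" "D \<in> carrier (G Mod H)"
      and e: "quotient_endo G H \<phi> C = quotient_endo G H \<phi> D"
    then obtain x y where x: "x \<in> carrier G" "C = H #> x" and y: "y \<in> carrier G" "D = H #> y"
      by (auto simp: FactGroup_def RCOSETS_def)
    have "H #> \<phi> x = H #> \<phi> y" using e x(2) y(2) *[OF x(1)] *[OF y(1)] by simp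
    then obtain n where n: "n \<in> H" "\<phi> x = n \<otimes> \<phi> y"
      using rcos_eq_imp_diff[OF \<phi>.hom_closed[OF x(1)] \<phi>.hom_closed[OF y(1)]] by blast
    then obtain m where m: "m \<in> H" "n = \<phi> m" using assms(2) by blast
    have "\<phi> x = \<phi> (m \<otimes> y)" using n m y(1) by simp
    then have "x = m \<otimes> y"
      using inj_onD[OF bij_betw_imp_inj_on[OF bij]] x(1) y(1) m(1) by simp
    moreover have "H #> m = H" using m(1) by (rule rcos_const[OF is_group])
    ultimately show "C = D"
      using x(2) y m(1) coset_mult_assoc[OF subset, of m y] by simp
  qed
  moreover have "quotient_endo G H \<phi> ` carrier (G Mod H) = carrier (G Mod H)"
  proof
    show "quotient_endo G H \<phi> ` carrier (G Mod H) \<subseteq> carrier (G Mod H)"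
      using hom by (auto simp: hom_def)
    show "carrier (G Mod H) \<subseteq> quotient_endo G H \<phi> ` carrier (G Mod H)"
    proof
      fix C assume "C \<in> carrier (G Mod H)"
      then obtain x where "x \<in> carrier G" "C = H #> x" by (auto simp: FactGroup_def RCOSETS_def)
      moreover then obtain z where "z \<in> carrier G" "x = \<phi> z" using bij by (auto simp: bij_betw_def)
      ultimately show "C \<in> quotient_endo G H \<phi> ` carrier (G Mod H)"
        using * by (intro image_eqI[of _ _ "H #> z"]) (auto simp: FactGroup_def RCOSETS_def)
    qed
  qed
  ultimately show "quotient_endo G H \<phi> \<in> iso (G Mod H) (G Mod H)"
    using hom by (simp add: iso_def bij_betw_def)
qed

lemma (in group) abelianization_map_iso:
  assumes "\<phi> \<in> iso G G"
  shows "\<And>g. g \<in> carrier G \<Longrightarrow>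
      abelianization_map G \<phi> (derived G (carrier G) #> g) = derived G (carrier G) #> \<phi> g"
    and "abelianization_map G \<phi> \<in> iso (abelianization G) (abelianization G)"
proof -
  interpret \<phi>: group_hom G G \<phi> using assms by unfold_locales (auto simp: iso_def)
  interpret N: normal "derived G (carrier G)" G by (rule derived_self_is_normal)
  have "\<phi> ` derived G (carrier G) = derived G (carrier G)"
    using \<phi>.derived_img[of "carrier G"] assms by (simp add: iso_def bij_betw_def)
  note * = N.quotient_endo_iso[OF assms this]
  show "\<And>g. g \<in> carrier G \<Longrightarrow>
      abelianization_map G \<phi> (derived G (carrier G) #> g) = derived G (carrier G) #> \<phi> g"
    unfolding abelianization_map_def by (rule *(1))
  show "abelianization_map G \<phi> \<in> iso (abelianization G) (abelianization G)"
    unfolding abelianization_map_def abelianization_def by (rule *(2))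
qed

end

theory Submission
  imports Defs
begin

text \<open>
  Write \<open>B\<close> for the abelianization, \<open>\<psi>\<close> for the automorphism of \<open>B\<close> induced by \<open>\<phi>\<close>, and \<open>d\<close> for
  the endomorphism \<open>y \<mapsto> \<psi> y \<otimes> inv y\<close> of \<open>B\<close>. Its kernel is \<open>Fix(\<psi>)\<close>. The hypothesis on the
  induced maps says \<open>f \<circ> \<phi> = f\<close>; as \<open>A\<close> is abelian, \<open>f\<close> factors through a homomorphism from \<open>B\<close>
  to \<open>A\<close>, and this homomorphism kills the image of \<open>d\<close>. So an element of infinite order in \<open>f(G)\<close>
  shows that the cokernel of \<open>d\<close> is not a torsion group.

  For an endomorphism of a finitely generated abelian group, kernel and cokernel have the same rank.
  Hence the kernel of \<open>d\<close> contains an element of infinite order, and its powers are infinitely many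
  fixed points. The half of the rank statement that matters is
  \<open>endomorphism_torsion_kernel_imp_torsion_cokernel\<close>: if the kernel is torsion, so is the cokernel.
  It rests on \<open>descending_chain_torsion_factor\<close>, a form of finiteness of rank: along a descending
  sequence of subgroups of a finitely generated abelian group, the successive factors cannot all
  contain elements of infinite order. Applied to the images of the powers of \<open>d\<close> and to the elements
  \<open>d\<^sup>k b\<close>, it gives \<open>d\<^sup>k (b\<^sup>m) = d\<^sup>k (d c)\<close> with \<open>m \<noteq> 0\<close>, and torsion of the kernel allows \<open>d\<^sup>k\<close> to be
  cancelled up to torsion.
\<close>

section \<open>Descending chains in finitely generated abelian groups\<close>

lemma (in comm_group) generate_insert_decompose:
  assumes s: "s \<in> carrier G" and S: "S \<subseteq> carrier G" and x: "x \<in> generate G (insert s S)"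
  shows "\<exists>a::int. \<exists>h \<in> generate G S. x = s [^] a \<otimes> h"
  using x
proof (induction rule: generate.induct)
  case one
  have "\<one> = s [^] (0::int) \<otimes> \<one>" by simp
  then show ?case using generate.one by blast
next
  case (incl y)
  show ?case
  proof (cases "y = s")
    case True
    have "y = s [^] (1::int) \<otimes> \<one>" using s True by simp
    then show ?thesis using generate.one by blast
  next
    case False
    then have y: "y \<in> S" using incl by simp
    then have "y = s [^] (0::int) \<otimes> y" using S by auto
    then show ?thesis using generate.incl[OF y] by blast
  qed
next
  case (inv y)
  show ?case
  proof (cases "y = s")
    case True
    have "inv y = s [^] (- 1::int) \<otimes> \<one>" using s True int_pow_neg[of s 1] by simp
    then show ?thesis using generate.one by blast
  next
    case False
    then have y: "y \<in> S" using inv by simp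
    then have "inv y = s [^] (0::int) \<otimes> inv y" using S by auto
    then show ?thesis using generate.inv[OF y] by blast
  qed
next
  case (eng y z)
  obtain a h where a: "h \<in> generate G S" "y = s [^] (a::int) \<otimes> h" using eng.IH(1) by blast
  obtain b k where b: "k \<in> generate G S" "z = s [^] (b::int) \<otimes> k" using eng.IH(2) by blast
  have hk: "h \<in> carrier G" "k \<in> carrier G" using a b S generate_in_carrier by blast+
  have "y \<otimes> z = (s [^] a \<otimes> s [^] b) \<otimes> (h \<otimes> k)"
    using a(2) b(2) s hk by (simp add: m_ac)
  then have "y \<otimes> z = s [^] (a + b) \<otimes> (h \<otimes> k)" using s by (simp add: int_pow_mult)
  then show ?case using generate.eng[OF a(1) b(1)] by blast
qed

text \<open>
  A descending chain of subgroups of a group of rank \<open>r\<close> has at most \<open>r\<close> factors that are not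
  torsion. The proof eliminates the generators one by one. If the exponents of a generator \<open>s\<close> in
  chosen expressions of the \<open>x i\<close> vanish from some point on, the rest of the chain needs one generator less. Otherwise each
  \<open>x i\<close> is combined with a later \<open>x j\<close> that involves \<open>s\<close>, so that \<open>s\<close> cancels. Since \<open>x j\<close> lies in
  \<open>H (Suc i)\<close>, this changes \<open>x i\<close> modulo \<open>H (Suc i)\<close> only by passing to a nontrivial power.
\<close>

lemma (in comm_group) descending_chain_torsion_factor:
  assumes "finite S" "S \<subseteq> carrier G"
    and "\<And>i. subgroup (H i) G" "antimono H"
    and "\<And>i::nat. x i \<in> H i" "\<And>i. x i \<in> generate G S"
  shows "\<exists>k. \<exists>m::int. m \<noteq> 0 \<and> x k [^] m \<in> H (Suc k)"
  using assms
proof (induction S arbitrary: H x rule: finite_induct)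
  case empty
  then have "x 0 = \<one>" using generate_empty by auto
  then have "x 0 [^] (1::int) \<in> H (Suc 0)" using subgroup.one_closed[OF empty.prems(2)] by simp
  then show ?case by (intro exI[of _ 0] exI[of _ 1]) simp
next
  case (insert s S)
  have s: "s \<in> carrier G" and S: "S \<subseteq> carrier G" using insert.prems(1) by auto
  have sgS: "subgroup (generate G S) G" by (rule generate_is_subgroup[OF S])
  note sgH = insert.prems(2)
  have "\<forall>i. \<exists>a::int. \<exists>h. h \<in> generate G S \<and> x i = s [^] a \<otimes> h"
    using generate_insert_decompose[OF s S insert.prems(5)] by blast
  then obtain a h where h: "\<And>i. h i \<in> generate G S"
    and xi: "\<And>i. x i = s [^] (a i :: int) \<otimes> h i" by metis
  have hc: "h i \<in> carrier G" for i using h generate_in_carrier[OF S] by blast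
  have xc: "x i \<in> carrier G" for i using xi hc s by simp
  show ?case
  proof (cases "\<exists>K. \<forall>i\<ge>K. a i = 0")
    case True
    then obtain K where K: "\<And>i. i \<ge> K \<Longrightarrow> a i = 0" by blast
    have "\<exists>k. \<exists>m::int. m \<noteq> 0 \<and> x (K + k) [^] m \<in> H (K + Suc k)"
    proof (rule insert.IH[of "\<lambda>i. H (K + i)" "\<lambda>i. x (K + i)", OF S])
      show "antimono (\<lambda>i. H (K + i))"
        using insert.prems(3) by (simp add: monotone_def)
      show "x (K + i) \<in> generate G S" for i using xi[of "K + i"] K[of "K + i"] h hc by simp
    qed (use insert.prems in auto)
    then show ?thesis by (metis add_Suc_right)
  next
    case False
    then have "\<forall>i. \<exists>j>i. a j \<noteq> 0" by (meson Suc_le_eq)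
    then obtain \<sigma> where \<sigma>: "\<And>i. \<sigma> i > i" "\<And>i. a (\<sigma> i) \<noteq> 0" by metis
    \<comment> \<open>The exponents make \<open>s\<close> cancel: it occurs with total exponent \<open>a i * a (\<sigma> i) - a (\<sigma> i) * a i\<close>.\<close>
    define y where "y i = x i [^] a (\<sigma> i) \<otimes> x (\<sigma> i) [^] (- a i)" for i
    have x\<sigma>: "x (\<sigma> i) \<in> H (Suc i)" for i
      using insert.prems(3,4) \<sigma>(1)[of i] unfolding monotone_def by (meson Suc_leI in_mono)
    have x\<sigma>pow: "x (\<sigma> i) [^] (n::int) \<in> H (Suc i)" for i n
      using subgroup_int_pow_closed[OF sgH x\<sigma>] .
    have le: "H (Suc i) \<subseteq> H i" for i using insert.prems(3) by (simp add: monotone_def)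
    have yS: "y i \<in> generate G S" for i
    proof -
      have "y i = (s [^] (a i * a (\<sigma> i)) \<otimes> s [^] (a (\<sigma> i) * (- a i)))
                  \<otimes> (h i [^] a (\<sigma> i) \<otimes> h (\<sigma> i) [^] (- a i))"
        unfolding y_def xi using s hc by (simp add: int_pow_distrib int_pow_pow m_ac)
      also have "\<dots> = h i [^] a (\<sigma> i) \<otimes> h (\<sigma> i) [^] (- a i)"
        using s hc by (simp add: int_pow_mult[symmetric] mult.commute)
      also have "\<dots> \<in> generate G S"
        by (intro subgroup.m_closed[OF sgS] subgroup_int_pow_closed[OF sgS] h)
      finally show ?thesis .
    qed
    have yH: "y i \<in> H i" for i
      unfolding y_def
      using subgroup.m_closed[OF sgH subgroup_int_pow_closed[OF sgH insert.prems(4)]] x\<sigma>pow le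
      by blast
    obtain k m where m: "m \<noteq> 0" "y k [^] (m::int) \<in> H (Suc k)"
      using insert.IH[of H y, OF S sgH insert.prems(3) yH yS] by blast
    have "x k [^] (a (\<sigma> k) * m) = y k [^] m \<otimes> x (\<sigma> k) [^] (a k * m)"
    proof -
      have "y k [^] m = x k [^] (a (\<sigma> k) * m) \<otimes> x (\<sigma> k) [^] (- (a k * m))"
        unfolding y_def using xc by (simp add: int_pow_distrib int_pow_pow)
      then show ?thesis
        using xc by (simp add: m_assoc int_pow_mult[symmetric])
    qed
    then have "x k [^] (a (\<sigma> k) * m) \<in> H (Suc k)"
      using subgroup.m_closed[OF sgH m(2) x\<sigma>pow] by simp
    then show ?thesis using m(1) \<sigma>(2)[of k] by (metis mult_eq_0_iff)
  qed
qed

section \<open>Kernel and cokernel of an endomorphism\<close>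

lemma funpow_hom:
  assumes "d \<in> hom G G"
  shows "(d ^^ k) \<in> hom G G"
proof (induction k)
  case 0
  show ?case by (simp add: hom_def)
next
  case (Suc k)
  then show ?case using hom_compose[OF Suc assms] by (simp add: comp_def)
qed

text \<open>
  If \<open>d\<close> maps \<open>(d ^^ k) x\<close> to the identity, torsion of the kernel makes a nontrivial power of
  \<open>(d ^^ k) x\<close> trivial. So \<open>d\<close> can be cancelled at the price of a power, one application at a time.
\<close>

lemma (in group) funpow_kernel_torsion:
  assumes d: "d \<in> hom G G"
    and tors: "\<And>x. x \<in> carrier G \<Longrightarrow> d x = \<one> \<Longrightarrow> ord x \<noteq> 0"
    and "x \<in> carrier G" "(d ^^ k) x = \<one>"
  shows "\<exists>n::int. n \<noteq> 0 \<and> x [^] n = \<one>"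
  using assms(3,4)
proof (induction k arbitrary: x)
  case 0
  then show ?case by (intro exI[of _ 1]) simp
next
  case (Suc k)
  have dk: "(d ^^ k) \<in> hom G G" by (rule funpow_hom[OF d])
  have c: "(d ^^ k) x \<in> carrier G" using dk Suc.prems(1) by (auto simp: hom_def)
  define n where "n = int (ord ((d ^^ k) x))"
  have n: "n \<noteq> 0" using tors[OF c] Suc.prems(2) by (simp add: n_def)
  have "(d ^^ k) (x [^] n) = (d ^^ k) x [^] n"
    by (rule hom_int_pow[OF dk Suc.prems(1) is_group is_group])
  also have "\<dots> = \<one>" using c by (simp add: n_def int_pow_eq_id)
  finally obtain m :: int where "m \<noteq> 0" "(x [^] n) [^] m = \<one>"
    using Suc.IH[of "x [^] n"] Suc.prems(1) by auto
  then show ?case using n Suc.prems(1) by (intro exI[of _ "n * m"]) (simp add: int_pow_pow)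
qed

text \<open>
  The images of the powers of \<open>d\<close> form a descending chain, so some nontrivial power of \<open>(d ^^ k) b\<close>
  is \<open>(d ^^ k) (d c)\<close>. By the previous lemma \<open>b [^] m\<close> and \<open>d c\<close> then agree up to torsion.
\<close>

lemma (in comm_group) endomorphism_torsion_kernel_imp_torsion_cokernel:
  assumes S: "finite S" "S \<subseteq> carrier G" "generate G S = carrier G"
    and d: "d \<in> hom G G"
    and tors: "\<And>x. x \<in> carrier G \<Longrightarrow> d x = \<one> \<Longrightarrow> ord x \<noteq> 0"
    and b: "b \<in> carrier G"
  shows "\<exists>m::int. m \<noteq> 0 \<and> b [^] m \<in> d ` carrier G"
proof -
  interpret d: group_hom G G d using d by unfold_locales
  have dk: "group_hom G G (d ^^ k)" for k using funpow_hom[OF d, of k] by unfold_locales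
  have dkc: "(d ^^ k) x \<in> carrier G" if "x \<in> carrier G" for k x
    by (rule group_hom.hom_closed[OF dk that])
  have step: "(d ^^ Suc k) ` carrier G \<subseteq> (d ^^ k) ` carrier G" for k
    by (auto simp: funpow_swap1)
  have "\<exists>k. \<exists>m::int. m \<noteq> 0 \<and> (d ^^ k) b [^] m \<in> (d ^^ Suc k) ` carrier G"
  proof (rule descending_chain_torsion_factor[OF S(1,2)])
    show "subgroup ((d ^^ i) ` carrier G) G" for i by (rule group_hom.img_is_subgroup[OF dk])
    show "antimono (\<lambda>i. (d ^^ i) ` carrier G)"
      using step by (intro decseq_SucI)
    show "(d ^^ i) b \<in> (d ^^ i) ` carrier G" for i using b by blast
    show "(d ^^ i) b \<in> generate G S" for i using S(3) dkc[OF b] by simp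
  qed
  then obtain k m c where m: "m \<noteq> 0" and c: "c \<in> carrier G"
    and eq: "(d ^^ k) b [^] (m::int) = (d ^^ k) (d c)"
    by (auto simp: funpow_swap1)
  define x where "x = b [^] m \<otimes> inv (d c)"
  have x: "x \<in> carrier G" using b c by (simp add: x_def)
  have "(d ^^ k) x = (d ^^ k) b [^] m \<otimes> inv ((d ^^ k) (d c))"
    unfolding x_def using b c
    by (simp add: group_hom.hom_mult[OF dk] group_hom.hom_inv[OF dk] group_hom.hom_int_pow[OF dk])
  then have "(d ^^ k) x = \<one>" using eq dkc c by simp
  then obtain n :: int where n: "n \<noteq> 0" "x [^] n = \<one>"
    using funpow_kernel_torsion[OF d tors x] by blast
  have "b [^] m = x \<otimes> d c" using b c by (simp add: x_def m_assoc)
  then have "b [^] (m * n) = d (c [^] n)"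
    using b c x n(2) by (simp add: int_pow_pow[symmetric] int_pow_distrib d.hom_int_pow)
  then show ?thesis using m n(1) c by (intro exI[of _ "m * n"]) auto
qed

section \<open>Fixed points\<close>

lemma (in group) subgroup_finite_imp_ord_nonzero:
  assumes "subgroup H G" "finite H" "x \<in> H"
  shows "ord x \<noteq> 0"
proof -
  have "carrier (subgroup_generated G {x}) \<subseteq> H"
    using assms by (intro subgroup_generated_minimal) auto
  then show ?thesis
    using finite_cyclic_subgroup_order subgroup.mem_carrier[OF assms(1,3)] finite_subset[OF _ assms(2)]
    by blast
qed

text \<open>
  The invariance of \<open>f\<close> says that \<open>f\<close> kills the image of \<open>y \<mapsto> \<psi> y \<otimes> inv y\<close>, and the kernel of that
  map is \<open>Fix G \<psi>\<close>. If the kernel were finite, some \<open>b [^] m\<close> with \<open>m \<noteq> 0\<close> would lie in the image, and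
  \<open>f b\<close> would have finite order.
\<close>

lemma (in comm_group) infinite_Fix_if_invariant_hom:
  assumes S: "finite S" "S \<subseteq> carrier G" "generate G S = carrier G"
    and \<psi>: "\<psi> \<in> hom G G" and A: "group A" and f: "f \<in> hom G A"
    and inv: "\<And>y. y \<in> carrier G \<Longrightarrow> f (\<psi> y) = f y"
    and b: "b \<in> carrier G" "group.ord A (f b) = 0"
  shows "infinite (Fix G \<psi>)"
proof
  assume fin: "finite (Fix G \<psi>)"
  interpret \<psi>: group_hom G G \<psi> using \<psi> by unfold_locales
  interpret A: group A by fact
  interpret f: group_hom G A f using f by unfold_locales
  define d where "d y = \<psi> y \<otimes> inv y" for y
  have d: "d \<in> hom G G"
    by (rule homI) (auto simp: d_def inv_mult m_ac)
  interpret d: group_hom G G d using d by unfold_locales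
  have ker: "kernel G G d = Fix G \<psi>"
    by (auto simp: kernel_def Fix_def d_def inv_solve_right' dest: inv_equality)
  have "ord x \<noteq> 0" if "x \<in> carrier G" "d x = \<one>" for x
    using subgroup_finite_imp_ord_nonzero[OF d.subgroup_kernel] ker fin that
    by (simp add: kernel_def)
  then obtain m :: int and c where m: "m \<noteq> 0" and c: "c \<in> carrier G" "b [^] m = d c"
    using endomorphism_torsion_kernel_imp_torsion_cokernel[OF S d _ b(1)] by blast
  have "f b [^]\<^bsub>A\<^esub> m = f (d c)" using b(1) c(2) f.hom_int_pow by metis
  also have "\<dots> = \<one>\<^bsub>A\<^esub>" using c(1) inv by (simp add: d_def)
  finally show False using b m by (simp add: A.int_pow_eq_id)
qed

theorem theorem5p1:
  fixes G :: "('a, 'm) monoid_scheme" and A :: "('b, 'n) monoid_scheme"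
    and \<phi> :: "'a \<Rightarrow> 'a" and f :: "'a \<Rightarrow> 'b" and N :: "'a set"
  assumes "group G" and "finitely_generated_group G"
    and "\<phi> \<in> iso G G"
    and "comm_group A"
    and "f \<in> hom G A" and "\<not> trivial_homomorphism G A f"
    and "\<exists>a \<in> f ` carrier G. group.ord A a = 0"
    and "N \<lhd> G" and "\<phi> ` N = N" and "N \<subseteq> kernel G A f"
    and "\<forall>C \<in> carrier (G Mod N).
           (quotient_map G N f \<circ> quotient_endo G N \<phi>) C = quotient_map G N f C"
  shows "infinite (Fix (abelianization G) (abelianization_map G \<phi>))"
proof -
  interpret G: group G by fact
  interpret A: comm_group A by fact
  interpret f: group_hom G A f using assms(5) by unfold_locales
  interpret N: normal N G by fact
  interpret \<phi>: group_hom G G \<phi> using assms(3) by unfold_locales (simp add: iso_def)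
  let ?D = "derived G (carrier G)"
  let ?B = "abelianization G"
  let ?F = "quotient_map G ?D f"
  interpret D: normal ?D G by (rule G.derived_self_is_normal)
  interpret B: comm_group ?B
    unfolding abelianization_def by (rule G.derived_quot_is_comm_group)
  have inv: "f (\<phi> g) = f g" if g: "g \<in> carrier G" for g
  proof -
    have "N #>\<^bsub>G\<^esub> g \<in> carrier (G Mod N)" using g by (auto simp: FactGroup_def RCOSETS_def)
    then have "quotient_map G N f (quotient_endo G N \<phi> (N #>\<^bsub>G\<^esub> g)) = quotient_map G N f (N #>\<^bsub>G\<^esub> g)"
      using assms(11) by simp
    then show ?thesis
      using g N.quotient_endo_iso(1)[OF assms(3,9) g]
        N.quotient_map_hom(1)[OF A.is_group assms(5,10)] by simp
  qed
  have "f ` ?D = {\<one>\<^bsub>A\<^esub>}"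
    using f.derived_img[of "carrier G"] A.derived_eq_singleton[of "f ` carrier G"] f.hom_closed
    by (simp add: image_subset_iff)
  then have ker: "?D \<subseteq> kernel G A f"
    using D.subset by (auto simp: kernel_def)
  note F = D.quotient_map_hom[OF A.is_group assms(5) ker]
  note \<psi> = G.abelianization_map_iso[OF assms(3)]
  have carrier_B: "carrier ?B = (\<lambda>g. ?D #>\<^bsub>G\<^esub> g) ` carrier G"
    by (auto simp: abelianization_def FactGroup_def RCOSETS_def)
  obtain S where S: "finite S" "S \<subseteq> carrier G" "generate G S = carrier G"
    using assms(2) unfolding finitely_generated_group_def by blast
  interpret p: group_hom G ?B "\<lambda>g. ?D #>\<^bsub>G\<^esub> g"
    using D.r_coset_hom_Mod by unfold_locales (simp add: abelianization_def)
  obtain g where g: "g \<in> carrier G" "group.ord A (f g) = 0" using assms(7) by blast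
  show ?thesis
  proof (rule B.infinite_Fix_if_invariant_hom)
    show "finite ((\<lambda>g. ?D #>\<^bsub>G\<^esub> g) ` S)" using S(1) by simp
    show "(\<lambda>g. ?D #>\<^bsub>G\<^esub> g) ` S \<subseteq> carrier ?B" using S(2) carrier_B by blast
    show "generate ?B ((\<lambda>g. ?D #>\<^bsub>G\<^esub> g) ` S) = carrier ?B"
      using p.generate_img[OF S(2)] S(3) carrier_B by simp
    show "abelianization_map G \<phi> \<in> hom ?B ?B" using \<psi>(2) by (simp add: iso_def)
    show "group A" by (rule A.is_group)
    show "?F \<in> hom ?B A" using F(2) by (simp add: abelianization_def)
    show "?F (abelianization_map G \<phi> y) = ?F y" if "y \<in> carrier ?B" for y
      using that \<psi>(1) F(1) inv by (auto simp: carrier_B)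
    show "?D #>\<^bsub>G\<^esub> g \<in> carrier ?B" using g(1) carrier_B by blast
    show "group.ord A (?F (?D #>\<^bsub>G\<^esub> g)) = 0" using g F(1) by simp
  qed
qed

end
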